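(* Let $k > 1$ be an integer, let $n \geq 1$ be an integer, and let $G$ be a simple graph on $n$ vertices. Let $c : E(G) \to \{1, \dots, n\}$ be a function such that $|c^{-1}(i)| \geq 301\, k \log k$ for all $i \in \{1, \dots, n\}$. Then $G$ contains a rainbow cycle (with respect to $c$) of length at most $\lceil n/k \rceil$.
   Context: Graphs are finite. A graph is simple if it has no loops or parallel edges. $\log$ denotes the logarithm with base $2$. The function $c$ is called a coloring of the edges of $G$; it is not required to be a proper edge-coloring (edges sharing an end may receive the same color). A rainbow cycle with respect to $c$ is a cycle $C$ in $G$ such that $c(e) \neq c(f)$ for all $e, f \in E(C)$ with $e \neq f$. The length of a cycle is its number of edges. *)

theory Defs
  imports Complex_Main "HOL-Library.FuncSet"
begin

text \<open>A finite simple graph with vertex set \<open>V\<close> and edge set \<open>E\<close>. Edges are two-element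
  sets of vertices, which excludes both loops and parallel edges.\<close>

locale simple_graph =
  fixes V :: "'a set" and E :: "'a set set"
  assumes finite_verts: "finite V"
    and edge_subset: "e \<in> E \<Longrightarrow> e \<subseteq> V"
    and edge_card: "e \<in> E \<Longrightarrow> card e = 2"

text \<open>A cycle is given by the list of its vertices in cyclic order; the first vertex is not
  repeated at the end, and the closing edge is the one obtained for \<open>i = length vs - 1\<close>.\<close>

definition cycle_edges :: "'a list \<Rightarrow> 'a set set" where
  "cycle_edges vs = {{vs ! i, vs ! (Suc i mod length vs)} | i. i < length vs}"

definition cycle_in :: "'a set \<Rightarrow> 'a set set \<Rightarrow> 'a list \<Rightarrow> bool" where
  "cycle_in V E vs \<longleftrightarrow>
     length vs \<ge> 3 \<and> distinct vs \<and> set vs \<subseteq> V \<and> cycle_edges vs \<subseteq> E"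

definition cycle_length :: "'a list \<Rightarrow> nat" where
  "cycle_length vs = card (cycle_edges vs)"

definition rainbow :: "('a set \<Rightarrow> 'c) \<Rightarrow> 'a list \<Rightarrow> bool" where
  "rainbow c vs \<longleftrightarrow> (\<forall>e \<in> cycle_edges vs. \<forall>f \<in> cycle_edges vs. e \<noteq> f \<longrightarrow> c e \<noteq> c f)"

text \<open>The number of edges agrees with the number of listed vertices; in particular distinct
  positions yield distinct edges, as there are at least three vertices.\<close>

lemma cycle_length_eq_length:
  assumes "length vs \<ge> 3" "distinct vs"
  shows "cycle_length vs = length vs"
proof -
  let ?n = "length vs"
  let ?s = "\<lambda>i. Suc i mod ?n"
  have s: "?s i = (if Suc i = ?n then 0 else Suc i)" if "i < ?n" for i
    using that by auto
  have "inj_on (\<lambda>i. {vs ! i, vs ! ?s i}) {..<?n}"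
  proof (rule inj_onI)
    fix i j
    assume ij: "i \<in> {..<?n}" "j \<in> {..<?n}" and eq: "{vs ! i, vs ! ?s i} = {vs ! j, vs ! ?s j}"
    have lt: "i < ?n" "j < ?n" "?s i < ?n" "?s j < ?n"
      using ij by (auto simp: s)
    have "i = j \<or> (i = ?s j \<and> ?s i = j)"
      using eq lt assms(2) unfolding doubleton_eq_iff by (auto simp: nth_eq_iff_index_eq)
    then show "i = j"
      using lt assms(1) s[of i] s[of j] by (auto split: if_splits)
  qed
  moreover have "cycle_edges vs = (\<lambda>i. {vs ! i, vs ! ?s i}) ` {..<?n}"
    by (auto simp: cycle_edges_def)
  ultimately show ?thesis
    by (simp add: cycle_length_def card_image)
qed

end

theory Submission
  imports Defs
begin

text \<open>Let \<open>T\<close> be about \<open>16 k log k\<close>. A rainbow graph with \<open>m \<le> n\<close> vertices and at least \<open>m + T\<close>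
  edges has a cycle of length at most \<open>n / k\<close>, because balls in a suitable subgraph grow by a factor
  \<open>1 + T / m\<close> until they contain a cycle. So deleting a set \<open>Z\<close> of \<open>2 T\<close> vertices yields the desired
  cycle if at most \<open>T\<close> colors disappear. Call a vertex a centre if it lies on all edges of some
  color. If there are at least \<open>16 T\<close> non-centres, a random set \<open>Z\<close> of non-centres works: it is too
  small to destroy a star, and to destroy any other color it has to contain one of four specific
  pairs of vertices. Otherwise, each centre keeps at least \<open>2 k - 1\<close> edges of its color inside the
  set of centres; orienting these away from the centre gives a digraph whose directed cycles are
  rainbow, and a digraph with minimum out-degree \<open>r\<close> has a directed cycle of length at most
  \<open>2 n / (r + 1)\<close>.\<close>

section \<open>Walks, cycles and short closed walks in digraphs\<close>

text \<open>Induction on the walk: if the new end vertex already lies on the path, the path is cut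
  off there, which only shortens it.\<close>

lemma relpow_imp_distinct_path:
  assumes "(a, b) \<in> R ^^ l"
  shows "\<exists>xs. xs \<noteq> [] \<and> distinct xs \<and> hd xs = a \<and> last xs = b \<and> length xs \<le> Suc l \<and>
    (\<forall>i. Suc i < length xs \<longrightarrow> (xs ! i, xs ! Suc i) \<in> R)"
  using assms
proof (induction l arbitrary: b)
  case 0
  then show ?case by (intro exI[of _ "[a]"]) auto
next
  case (Suc l)
  then obtain z where z: "(a, z) \<in> R ^^ l" "(z, b) \<in> R" by auto
  from Suc.IH[OF z(1)] obtain xs where xs: "xs \<noteq> []" "distinct xs" "hd xs = a" "last xs = z"
    "length xs \<le> Suc l" "\<And>i. Suc i < length xs \<Longrightarrow> (xs ! i, xs ! Suc i) \<in> R" by blast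
  show ?case
  proof (cases "b \<in> set xs")
    case True
    then obtain j where j: "j < length xs" "xs ! j = b" by (auto simp: in_set_conv_nth)
    then have "last (take (Suc j) xs) = b" by (simp add: take_Suc_conv_app_nth)
    with xs j show ?thesis
      by (intro exI[of _ "take (Suc j) xs"]) auto
  next
    case False
    have "((xs @ [b]) ! i, (xs @ [b]) ! Suc i) \<in> R" if "Suc i < length (xs @ [b])" for i
    proof (cases "Suc i < length xs")
      case True
      then show ?thesis using xs(6) by (simp add: nth_append)
    next
      case False
      then have "i = length xs - 1" "Suc i = length xs" using that by auto
      then show ?thesis using xs(1,4) z(2) by (simp add: nth_append last_conv_nth)
    qed
    with False xs show ?thesis
      by (intro exI[of _ "xs @ [b]"]) auto
  qed
qed

text \<open>The closing arc has its own relation \<open>Q\<close>: for digraphs this is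
  \<open>R\<close> itself, for undirected graphs it is a single edge that the walk must avoid. The
  hypothesis \<open>(a, b) \<notin> R\<close> excludes going back and forth between two
  vertices.\<close>

lemma relpow_imp_cycle_arcs:
  assumes "(a, b) \<in> R ^^ l" "(b, a) \<in> Q" "a \<noteq> b" "(a, b) \<notin> R"
  shows "\<exists>xs. distinct xs \<and> 3 \<le> length xs \<and> length xs \<le> Suc l \<and>
    (\<forall>i < length xs. (xs ! i, xs ! (Suc i mod length xs)) \<in> R \<union> Q)"
proof -
  obtain xs where xs: "xs \<noteq> []" "distinct xs" "hd xs = a" "last xs = b"
    "length xs \<le> Suc l" "\<And>i. Suc i < length xs \<Longrightarrow> (xs ! i, xs ! Suc i) \<in> R"
    using relpow_imp_distinct_path[OF assms(1)] by blast
  have ends: "xs ! 0 = a" "xs ! (length xs - 1) = b"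
    using xs by (simp_all add: hd_conv_nth last_conv_nth)
  have "length xs \<noteq> 1" using ends assms(3) by auto
  moreover have "length xs \<noteq> 2" using ends assms(4) xs(6)[of 0] by auto
  moreover have "length xs \<noteq> 0" using xs(1) by simp
  ultimately have "3 \<le> length xs" by linarith
  moreover have "(xs ! i, xs ! (Suc i mod length xs)) \<in> R \<union> Q" if "i < length xs" for i
  proof (cases "Suc i < length xs")
    case True
    then show ?thesis using xs(6) by simp
  next
    case False
    then have "Suc i = length xs" using that by simp
    then show ?thesis using ends assms(2) by (metis Un_iff diff_Suc_1 mod_self)
  qed
  ultimately show ?thesis using xs by blast
qed

text \<open>The induction of Chvatal and Szemeredi: delete a vertex \<open>v\<close> of large in-degree together with
  its predecessors, and let every vertex that had an arc into the deleted set point to all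
  successors of \<open>v\<close> instead. A new arc stands for a walk of length 3 through \<open>v\<close>; since all of these
  walks meet in \<open>v\<close>, only one of them is needed to turn a closed walk of the new digraph into one of
  the old digraph, at the cost of two additional arcs.\<close>

lemma short_closed_walk:
  assumes "finite U" "U \<noteq> {}" "A \<subseteq> U \<times> U" "1 \<le> r"
    and "\<And>x. x \<in> U \<Longrightarrow> r \<le> card (A `` {x})"
  shows "\<exists>x l. 1 \<le> l \<and> (x, x) \<in> A ^^ l \<and> l * Suc r \<le> 2 * card U"
  using assms
proof (induction "card U" arbitrary: U A rule: less_induct)
  case less
  have finA: "finite A" using less.prems(1,3) finite_subset by blast
  have out_sub: "A `` {x} \<subseteq> U" for x using less.prems(3) by auto
  have "r \<le> card U"
    using less.prems out_sub by (meson card_mono ex_in_conv le_trans)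
  show ?case
  proof (cases "\<exists>x. (x, x) \<in> A")
    case True
    then obtain x where "(x, x) \<in> A ^^ 1" by auto
    with \<open>r \<le> card U\<close> \<open>1 \<le> r\<close> show ?thesis by (intro exI[of _ x] exI[of _ 1]) auto
  next
    case noloop: False
    \<comment> \<open>In-degrees and out-degrees both sum to \<open>card A\<close>, so some
      in-degree reaches the lower bound on the out-degrees.\<close>
    have "\<exists>v \<in> U. r \<le> card (A\<inverse> `` {v})"
    proof (rule ccontr)
      assume "\<not> ?thesis"
      then have "(\<Sum>v\<in>U. card (A\<inverse> `` {v})) < (\<Sum>v\<in>U. r)"
        using less.prems(1,2) by (intro sum_strict_mono) auto
      also have "\<dots> \<le> (\<Sum>v\<in>U. card (A `` {v}))"
        using less.prems(5) by (intro sum_mono)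
      also have "\<dots> = card A"
      proof -
        have "A = (SIGMA v:U. A `` {v})" using less.prems(3) by auto
        then show ?thesis
          using less.prems(1) finA card_SigmaI[of U "\<lambda>v. A `` {v}"] by (metis finite_Image)
      qed
      also have "\<dots> = card (A\<inverse>)" by simp
      also have "\<dots> = (\<Sum>v\<in>U. card (A\<inverse> `` {v}))"
      proof -
        have "A\<inverse> = (SIGMA v:U. A\<inverse> `` {v})" using less.prems(3) by auto
        then show ?thesis
          using less.prems(1) finA card_SigmaI[of U "\<lambda>v. A\<inverse> `` {v}"]
          by (metis finite_Image finite_converse)
      qed
      finally show False by simp
    qed
    then obtain v where v: "v \<in> U" "r \<le> card (A\<inverse> `` {v})" by blast
    define P where "P = A\<inverse> `` {v}"
    define Q where "Q = A `` {v}"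
    have PQ: "P \<subseteq> U" "Q \<subseteq> U" "v \<notin> P" "v \<notin> Q" "r \<le> card P" "r \<le> card Q"
      using less.prems(3,5) v noloop by (auto simp: P_def Q_def)
    have fin: "finite P" "finite Q" using PQ less.prems(1) finite_subset by auto
    have cardvP: "card (insert v P) \<ge> Suc r" using PQ fin by simp
    \<comment> \<open>A common vertex of \<open>P\<close> and \<open>Q\<close> yields a closed walk
      of length 2. Otherwise \<open>Q\<close> survives the deletion and can receive the new
      arcs.\<close>
    show ?thesis
    proof (cases "P \<inter> Q = {}")
      case False
      then obtain u where "(u, v) \<in> A" "(v, u) \<in> A" by (auto simp: P_def Q_def)
      then have "(v, v) \<in> A ^^ 2" by (auto simp: numeral_2_eq_2)
      moreover have "Suc r \<le> card U"
        using cardvP card_mono[OF less.prems(1), of "insert v P"] PQ v by simp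
      ultimately show ?thesis by (intro exI[of _ v] exI[of _ 2]) simp
    next
      case True
      define U' where "U' = U - insert v P"
      define A' where "A' = A \<inter> U' \<times> U' \<union> {x \<in> U'. A `` {x} \<inter> P \<noteq> {}} \<times> Q"
      have "Q \<subseteq> U'" using True PQ by (auto simp: U'_def)
      have cardU: "card U' + card (insert v P) = card U"
        using card_Diff_subset[of "insert v P" U] card_mono[of U "insert v P"] fin PQ v less.prems(1)
        unfolding U'_def by simp
      have "U' \<noteq> {}" using \<open>Q \<subseteq> U'\<close> PQ(6) \<open>1 \<le> r\<close> by auto
      have "A' \<subseteq> U' \<times> U'" using \<open>Q \<subseteq> U'\<close> by (auto simp: A'_def)
      have "finite U'" using less.prems(1) by (simp add: U'_def)
      have out': "r \<le> card (A' `` {x})" if x: "x \<in> U'" for x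
      proof (cases "A `` {x} \<inter> P = {}")
        case True
        have "x \<notin> P" using x by (simp add: U'_def)
        then have "A `` {x} \<subseteq> A' `` {x}"
          using True x less.prems(3) by (auto simp: A'_def U'_def P_def)
        moreover have "finite (A' `` {x})"
          using \<open>A' \<subseteq> U' \<times> U'\<close> \<open>finite U'\<close> by (auto intro: finite_subset[of _ U'])
        ultimately show ?thesis
          using less.prems(5)[of x] x card_mono[of "A' `` {x}" "A `` {x}"] by (auto simp: U'_def)
      next
        case False
        then have "Q \<subseteq> A' `` {x}" using x by (auto simp: A'_def)
        moreover have "finite (A' `` {x})"
          using \<open>A' \<subseteq> U' \<times> U'\<close> \<open>finite U'\<close> by (auto intro: finite_subset[of _ U'])
        ultimately show ?thesis using card_mono PQ(6) le_trans by blast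
      qed
      have "card U' < card U" using cardU cardvP by simp
      from less.hyps[OF this \<open>finite U'\<close> \<open>U' \<noteq> {}\<close> \<open>A' \<subseteq> U' \<times> U'\<close> \<open>1 \<le> r\<close> out']
      obtain x l where xl: "1 \<le> l" "(x, x) \<in> A' ^^ l" "l * Suc r \<le> 2 * card U'" by blast
      \<comment> \<open>At least \<open>Suc r\<close> vertices were deleted, which pays for two
        additional arcs.\<close>
      have bound: "j * Suc r \<le> 2 * card U" if "j \<le> l + 2" for j
      proof -
        have "j * Suc r \<le> (l + 2) * Suc r" using that by (rule mult_le_mono1)
        also have "\<dots> \<le> 2 * card U" using xl(3) cardU cardvP by (simp add: algebra_simps)
        finally show ?thesis .
      qed
      have shortcut: "(z, w) \<in> A \<or> w \<in> Q \<and> (z, v) \<in> A ^^ 2" if "(z, w) \<in> A'" for z w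
      proof (cases "(z, w) \<in> A")
        case False
        then have "w \<in> Q" "A `` {z} \<inter> P \<noteq> {}" using that by (auto simp: A'_def)
        then show ?thesis by (auto simp: P_def numeral_2_eq_2)
      qed simp
      \<comment> \<open>Prefix the arc from \<open>v\<close> to \<open>y\<close>. If the walk then
        uses only arcs of \<open>A\<close>, the first alternative holds; at the first new arc it can
        instead be led back to \<open>v\<close> in two steps, where it closes.\<close>
      have walk: "(v, w) \<in> A ^^ Suc j \<or> (\<exists>i. 1 \<le> i \<and> i \<le> j + 2 \<and> (v, v) \<in> A ^^ i)"
        if "y \<in> Q" "(y, w) \<in> A' ^^ j" for y w j
        using that(2)
      proof (induction j arbitrary: w)
        case 0
        then show ?case using \<open>y \<in> Q\<close> by (auto simp: Q_def)
      next
        case (Suc j)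
        then obtain z where z: "(y, z) \<in> A' ^^ j" "(z, w) \<in> A'" by auto
        show ?case
        proof (cases "(v, z) \<in> A ^^ Suc j")
          case True
          then consider "(v, w) \<in> A ^^ Suc (Suc j)" | "(v, v) \<in> A ^^ (Suc j + 2)"
            using shortcut[OF z(2)] by (metis relcomp.relcompI relpow.simps(2) relpow_add)
          then show ?thesis
          proof cases
            case 2
            then show ?thesis by (intro disjI2 exI[of _ "Suc j + 2"]) simp
          qed simp
        next
          case False
          with Suc.IH[OF z(1)] show ?thesis by (metis add_Suc le_Suc_eq)
        qed
      qed
      have "(x, x) \<in> A ^^ l \<or> (\<exists>y i. 1 \<le> i \<and> i \<le> l + 2 \<and> (y, y) \<in> A ^^ i)"
      proof -
        have split: "(x, w) \<in> A ^^ j \<or> (\<exists>z y p q. (x, z) \<in> A' ^^ p \<and> (y, w) \<in> A' ^^ q \<and> y \<in> Q \<and>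
            (z, v) \<in> A ^^ 2 \<and> j = Suc (p + q))" if "(x, w) \<in> A' ^^ j" for w j
          using that
        proof (induction j arbitrary: w)
          case 0
          then show ?case by simp
        next
          case (Suc j)
          then obtain z where z: "(x, z) \<in> A' ^^ j" "(z, w) \<in> A'" by auto
          from Suc.IH[OF z(1)] show ?case
          proof
            assume xz: "(x, z) \<in> A ^^ j"
            from shortcut[OF z(2)] show ?thesis
            proof
              assume "(z, w) \<in> A"
              with xz show ?thesis by auto
            next
              assume "w \<in> Q \<and> (z, v) \<in> A ^^ 2"
              with z(1) show ?thesis
                by (intro disjI2 exI[of _ z] exI[of _ w] exI[of _ j] exI[of _ 0]) simp
            qed
          next
            assume "\<exists>z' y p q. (x, z') \<in> A' ^^ p \<and> (y, z) \<in> A' ^^ q \<and> y \<in> Q \<and>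
              (z', v) \<in> A ^^ 2 \<and> j = Suc (p + q)"
            then obtain z' y p q where *: "(x, z') \<in> A' ^^ p" "(y, z) \<in> A' ^^ q" "y \<in> Q"
              "(z', v) \<in> A ^^ 2" "j = Suc (p + q)" by blast
            then have "(y, w) \<in> A' ^^ Suc q" using z(2) by auto
            with * show ?thesis
              by (intro disjI2 exI[of _ z'] exI[of _ y] exI[of _ p] exI[of _ "Suc q"]) simp
          qed
        qed
        from split[OF xl(2)] show ?thesis
        proof
          assume "\<exists>z y p q. (x, z) \<in> A' ^^ p \<and> (y, x) \<in> A' ^^ q \<and> y \<in> Q \<and>
            (z, v) \<in> A ^^ 2 \<and> l = Suc (p + q)"
          then obtain z y p q where *: "(x, z) \<in> A' ^^ p" "(y, x) \<in> A' ^^ q" "y \<in> Q"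
            "(z, v) \<in> A ^^ 2" "l = Suc (p + q)" by blast
          \<comment> \<open>The closed walk is rotated: after the new arc from \<open>z\<close> to
            \<open>y\<close>, it runs from \<open>y\<close> through \<open>x\<close> to
            \<open>z\<close> in \<open>l - 1\<close> steps. One arc from \<open>v\<close> to
            \<open>y\<close> and two steps from \<open>z\<close> to \<open>v\<close> replace the new
            arc, for a total of \<open>l + 2\<close>.\<close>
          then have "(y, z) \<in> A' ^^ (q + p)" by (auto simp: relpow_add)
          from walk[OF \<open>y \<in> Q\<close> this]
          show ?thesis
          proof
            assume "(v, z) \<in> A ^^ Suc (q + p)"
            with *(4) have "(v, v) \<in> A ^^ (Suc (q + p) + 2)" unfolding relpow_add by blast
            then show ?thesis using *(5)
              by (intro disjI2 exI[of _ v] exI[of _ "Suc (q + p) + 2"]) simp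
          next
            assume "\<exists>i. 1 \<le> i \<and> i \<le> q + p + 2 \<and> (v, v) \<in> A ^^ i"
            then show ?thesis using *(5) by fastforce
          qed
        qed simp
      qed
      then show ?thesis using xl(1) bound by (metis le_add1)
    qed
  qed
qed

section \<open>Balls and short cycles in graphs with excess edges\<close>

definition adj :: "'a set set \<Rightarrow> ('a \<times> 'a) set" where
  "adj F = {(a, b). {a, b} \<in> F}"

definition ball_in :: "'a set set \<Rightarrow> 'a \<Rightarrow> nat \<Rightarrow> 'a set" where
  "ball_in F v r = {u. \<exists>j \<le> r. (v, u) \<in> adj F ^^ j}"

text \<open>Since the walk avoids the edge itself, the path extracted from it has at least two
  edges, and the edge closes it to a genuine cycle.\<close>

lemma cycle_through_edge:
  assumes "(a, b) \<in> adj (F - {{a, b}}) ^^ l" "{a, b} \<in> F" "a \<noteq> b"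
  shows "\<exists>xs. distinct xs \<and> 3 \<le> length xs \<and> length xs \<le> Suc l \<and> cycle_edges xs \<subseteq> F"
proof -
  have "(a, b) \<notin> adj (F - {{a, b}})" by (simp add: adj_def)
  from relpow_imp_cycle_arcs[OF assms(1) _ assms(3) this, of "{(b, a)}"]
  obtain xs where xs: "distinct xs" "3 \<le> length xs" "length xs \<le> Suc l"
    "\<And>i. i < length xs \<Longrightarrow> (xs ! i, xs ! (Suc i mod length xs)) \<in> adj (F - {{a, b}}) \<union> {(b, a)}"
    by auto
  have "cycle_edges xs \<subseteq> F"
    using xs(4) assms(2) by (fastforce simp: cycle_edges_def adj_def insert_commute)
  with xs show ?thesis by blast
qed

lemma relpow_adj_sym: "(a, b) \<in> adj F ^^ l \<Longrightarrow> (b, a) \<in> adj F ^^ l"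
proof (induction l arbitrary: b)
  case (Suc l)
  then obtain z where z: "(a, z) \<in> adj F ^^ l" "(z, b) \<in> adj F" by auto
  then have "(b, z) \<in> adj F" by (simp add: adj_def insert_commute)
  then show ?case using Suc.IH[OF z(1)] by (rule relpow_Suc_I2)
qed simp

lemma ball_in_subset:
  assumes "v \<in> Y" "\<Union>F \<subseteq> Y"
  shows "ball_in F v r \<subseteq> Y"
proof
  fix u assume "u \<in> ball_in F v r"
  then obtain j where "(v, u) \<in> adj F ^^ j" by (auto simp: ball_in_def)
  then show "u \<in> Y" using assms by (cases j) (auto simp: adj_def)
qed

text \<open>Every vertex of the ball other than the centre chooses an edge to a vertex closer to the
  centre. A further edge would close a cycle with the two descents from its ends.\<close>

lemma card_edges_ball_less:
  assumes card2: "\<And>e. e \<in> F \<Longrightarrow> card e = 2"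
    and fin: "finite (ball_in F v r)"
    and nocyc: "\<And>xs. distinct xs \<Longrightarrow> 3 \<le> length xs \<Longrightarrow> length xs \<le> 2 * r + 1 \<Longrightarrow>
      \<not> cycle_edges xs \<subseteq> F"
  shows "card {e \<in> F. e \<subseteq> ball_in F v r} < card (ball_in F v r)"
proof -
  let ?B = "ball_in F v r"
  define d where "d u = (LEAST j. (v, u) \<in> adj F ^^ j)" for u
  have d: "(v, u) \<in> adj F ^^ d u" "d u \<le> r" if "u \<in> ?B" for u
  proof -
    from that obtain j where j: "j \<le> r" "(v, u) \<in> adj F ^^ j" by (auto simp: ball_in_def)
    then show "(v, u) \<in> adj F ^^ d u" unfolding d_def by (auto intro: LeastI)
    show "d u \<le> r" using j unfolding d_def by (meson Least_le le_trans)
  qed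
  have "\<exists>p. p \<in> ?B \<and> d p < d u \<and> {u, p} \<in> F" if "u \<in> ?B - {v}" for u
  proof -
    have "d u \<noteq> 0" using d(1)[of u] that by (cases "d u") auto
    then obtain j where j: "d u = Suc j" by (cases "d u") auto
    have "(v, u) \<in> adj F ^^ Suc j" using d(1)[of u] that unfolding j by blast
    then obtain p where p: "(v, p) \<in> adj F ^^ j" "(p, u) \<in> adj F" by (rule relpow_Suc_E)
    have "p \<in> ?B" using p(1) j d(2)[of u] that by (auto simp: ball_in_def intro!: exI[of _ j])
    moreover have "d p \<le> j" using p(1) unfolding d_def by (rule Least_le)
    moreover have "{u, p} \<in> F" using p(2) by (simp add: adj_def insert_commute)
    ultimately show ?thesis using j by auto
  qed
  then obtain p where p: "\<And>u. u \<in> ?B - {v} \<Longrightarrow> p u \<in> ?B \<and> d (p u) < d u \<and> {u, p u} \<in> F" by metis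
  have "v \<in> ?B" by (auto simp: ball_in_def intro!: exI[of _ 0])
  \<comment> \<open>The centre \<open>v\<close> makes no choice, so fewer edges are chosen than the
    ball has vertices; this gives the strict inequality.\<close>
  have "{e \<in> F. e \<subseteq> ?B} \<subseteq> (\<lambda>u. {u, p u}) ` (?B - {v})"
  proof (rule ccontr)
    assume "\<not> ?thesis"
    then obtain e where e: "e \<in> F" "e \<subseteq> ?B" "e \<notin> (\<lambda>u. {u, p u}) ` (?B - {v})" by blast
    obtain a b where ab: "e = {a, b}" "a \<noteq> b" using card2[OF e(1)] by (meson card_2_iff)
    \<comment> \<open>Descents follow chosen edges only and therefore avoid \<open>e\<close>, so
      \<open>e\<close> can serve as the closing edge.\<close>
    have walk: "\<exists>j \<le> d u. (u, v) \<in> adj (F - {e}) ^^ j" if "u \<in> ?B" for u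
      using that
    proof (induction "d u" arbitrary: u rule: less_induct)
      case less
      show ?case
      proof (cases "u = v")
        case True
        then show ?thesis by (intro exI[of _ 0]) simp
      next
        case False
        with p less.prems have *: "p u \<in> ?B" "d (p u) < d u" "{u, p u} \<in> F" by auto
        from less.hyps[OF *(2,1)] obtain j where j: "j \<le> d (p u)" "(p u, v) \<in> adj (F - {e}) ^^ j"
          by blast
        have "(u, p u) \<in> adj (F - {e})" using *(3) e(3) False less.prems by (auto simp: adj_def)
        then have "(u, v) \<in> adj (F - {e}) ^^ Suc j" using j(2) by (rule relpow_Suc_I2)
        with j(1) *(2) show ?thesis by (intro exI[of _ "Suc j"]) simp
      qed
    qed
    from walk e(2) ab obtain i j where ij: "i \<le> d a" "(a, v) \<in> adj (F - {e}) ^^ i"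
      "j \<le> d b" "(b, v) \<in> adj (F - {e}) ^^ j" by (metis insert_subset)
    have "(a, b) \<in> adj (F - {{a, b}}) ^^ (i + j)"
      using ij(2) relpow_adj_sym[OF ij(4)] unfolding relpow_add ab(1) by blast
    from cycle_through_edge[OF this _ ab(2)] e(1) ab(1)
    obtain xs where "distinct xs" "3 \<le> length xs" "length xs \<le> Suc (i + j)" "cycle_edges xs \<subseteq> F"
      by auto
    moreover have "d a \<le> r" "d b \<le> r" using d(2) e(2) ab(1) by auto
    ultimately show False using nocyc[of xs] ij(1,3) by linarith
  qed
  then have "card {e \<in> F. e \<subseteq> ?B} \<le> card (?B - {v})"
    using fin by (meson card_image_le card_mono finite_Diff finite_imageI le_trans)
  also have "\<dots> < card ?B" using fin \<open>v \<in> ?B\<close> by (meson card_Diff1_less)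
  finally show ?thesis .
qed

text \<open>In a smallest nonempty vertex set \<open>Y\<close> with edge density at least \<open>1 + T / card X\<close>, every subset
  meets at least this multiple of its size in edges. So balls grow by this factor as long as they
  span trees.\<close>

lemma excess_edges_girth:
  fixes X :: "'a set" and T g :: nat
  assumes "finite X" "X \<noteq> {}"
    and F: "\<And>e. e \<in> F \<Longrightarrow> e \<subseteq> X \<and> card e = 2"
    and excess: "card X + T \<le> card F"
    and nocyc: "\<And>xs. distinct xs \<Longrightarrow> 3 \<le> length xs \<Longrightarrow> length xs \<le> g \<Longrightarrow> \<not> cycle_edges xs \<subseteq> F"
    and "1 \<le> g"
  shows "(1 + real T / real (card X)) ^ g \<le> (1 + real T)\<^sup>2"
proof -
  define \<epsilon> where "\<epsilon> = real T / real (card X)"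
  have cardX: "card X > 0" using assms(1,2) by (simp add: card_gt_0_iff)
  have \<epsilon>: "0 \<le> \<epsilon>" "\<epsilon> * card X = T" using cardX by (auto simp: \<epsilon>_def)
  define D where "D Y \<longleftrightarrow> Y \<subseteq> X \<and> Y \<noteq> {} \<and> (1 + \<epsilon>) * card Y \<le> card {e \<in> F. e \<subseteq> Y}" for Y
  have "{e \<in> F. e \<subseteq> X} = F" using F by auto
  moreover have "(1 + \<epsilon>) * card X \<le> card F"
    using excess \<epsilon>(2) by (simp add: distrib_right flip: of_nat_add)
  ultimately have "D X" using assms(2) by (simp add: D_def)
  then obtain Y where Y: "D Y" "\<And>Y'. D Y' \<Longrightarrow> card Y \<le> card Y'"
    using ex_has_least_nat[of D X card] by blast
  define G where "G = {e \<in> F. e \<subseteq> Y}"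
  have finY: "finite Y" using Y(1) assms(1) finite_subset by (auto simp: D_def)
  have finG: "finite G" unfolding G_def by (rule finite_subset[of _ "Pow Y"]) (use finY in auto)
  \<comment> \<open>By minimality of \<open>Y\<close>, the rest \<open>Y - B\<close> is empty or too
    sparse, so the edges lost with \<open>B\<close> amount to at least its share.\<close>
  have touch: "(1 + \<epsilon>) * card B \<le> card {e \<in> G. e \<inter> B \<noteq> {}}" if "B \<subseteq> Y" "B \<noteq> {}" for B
  proof -
    have split: "card G = card {e \<in> G. e \<inter> B \<noteq> {}} + card {e \<in> F. e \<subseteq> Y - B}"
    proof -
      have "G = {e \<in> G. e \<inter> B \<noteq> {}} \<union> {e \<in> F. e \<subseteq> Y - B}" by (auto simp: G_def)
      moreover have "card ({e \<in> G. e \<inter> B \<noteq> {}} \<union> {e \<in> F. e \<subseteq> Y - B})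
          = card {e \<in> G. e \<inter> B \<noteq> {}} + card {e \<in> F. e \<subseteq> Y - B}"
      proof (rule card_Un_disjoint)
        show "finite {e \<in> G. e \<inter> B \<noteq> {}}" using finG by simp
        show "finite {e \<in> F. e \<subseteq> Y - B}"
          using finG by (rule rev_finite_subset) (auto simp: G_def)
      qed auto
      ultimately show ?thesis by simp
    qed
    have cardYB: "card Y = card B + card (Y - B)"
      using card_Diff_subset[of B Y] card_mono[of Y B] that finY finite_subset by fastforce
    have B0: "card B > 0" using that finY finite_subset by (auto simp: card_gt_0_iff)
    have "real (card {e \<in> F. e \<subseteq> Y - B}) \<le> (1 + \<epsilon>) * card (Y - B)"
    proof (cases "Y - B = {}")
      case True
      have "{e \<in> F. e \<subseteq> Y - B} = {}" unfolding True using F by fastforce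
      then show ?thesis using \<epsilon>(1) by (simp only: card.empty) simp
    next
      case False
      have "\<not> D (Y - B)" using Y(2)[of "Y - B"] cardYB B0 by linarith
      with False Y(1) show ?thesis by (auto simp: D_def)
    qed
    moreover have "(1 + \<epsilon>) * card Y \<le> card G" using Y(1) by (simp add: D_def G_def)
    ultimately show ?thesis using split cardYB by (simp add: distrib_left)
  qed
  obtain v where v: "v \<in> Y" using Y(1) by (auto simp: D_def)
  define B where "B = ball_in G v"
  have BY: "B r \<subseteq> Y" for r
    unfolding B_def using v by (intro ball_in_subset) (auto simp: G_def)
  \<comment> \<open>Closed form of the recursion
    \<open>b (Suc r) \<ge> (1 + \<epsilon>) * b r + 1\<close>, \<open>b 0 = 1\<close> for the ball
    sizes. The \<open>+ 1\<close> comes from the strict edge bound; the side condition is there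
    because cycles found in a ball of radius \<open>r\<close> have length up to
    \<open>2 * r + 1\<close>.\<close>
  have growth: "(1 + \<epsilon>) ^ Suc r \<le> \<epsilon> * card (B r) + 1" if "2 * r + 1 \<le> g" for r
    using that
  proof (induction r)
    case 0
    have "B 0 = {v}" by (auto simp: B_def ball_in_def)
    then show ?case by simp
  next
    case (Suc r)
    have near: "y \<in> B (Suc r)" if e: "e \<in> G" "x \<in> e" "x \<in> B r" "y \<in> e" for e x y
    proof -
      obtain j where j: "j \<le> r" "(v, x) \<in> adj G ^^ j" using e(3) by (auto simp: B_def ball_in_def)
      show ?thesis
      proof (cases "y = x")
        case True
        with j show ?thesis by (auto simp: B_def ball_in_def intro!: exI[of _ j])
      next
        case False
        have "card e = 2" using e(1) F by (simp add: G_def)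
        with False e have "e = {x, y}" by (auto simp: card_2_iff)
        then have "(v, y) \<in> adj G ^^ Suc j" using j(2) e(1) by (auto simp: adj_def)
        with j(1) show ?thesis
          unfolding B_def ball_in_def by (intro CollectI exI[of _ "Suc j"]) simp
      qed
    qed
    have step: "{e \<in> G. e \<inter> B r \<noteq> {}} \<subseteq> {e \<in> G. e \<subseteq> B (Suc r)}"
      using near by blast
    have "card {e \<in> G. e \<subseteq> ball_in G v (Suc r)} < card (ball_in G v (Suc r))"
    proof (rule card_edges_ball_less)
      show "finite (ball_in G v (Suc r))" using BY finY finite_subset unfolding B_def by blast
      show "\<not> cycle_edges xs \<subseteq> G"
        if "distinct xs" "3 \<le> length xs" "length xs \<le> 2 * Suc r + 1" for xs
        using nocyc[of xs] that Suc.prems by (auto simp: G_def)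
    qed (use F in \<open>auto simp: G_def\<close>)
    moreover have "card {e \<in> G. e \<inter> B r \<noteq> {}} \<le> card {e \<in> G. e \<subseteq> B (Suc r)}"
      using step finG by (simp add: card_mono)
    ultimately have "card {e \<in> G. e \<inter> B r \<noteq> {}} + 1 \<le> card (B (Suc r))"
      unfolding B_def by linarith
    then have "real (card {e \<in> G. e \<inter> B r \<noteq> {}}) + 1 \<le> card (B (Suc r))" by linarith
    moreover have "B r \<noteq> {}" by (auto simp: B_def ball_in_def intro!: exI[of _ v] exI[of _ 0])
    ultimately have 1: "(1 + \<epsilon>) * card (B r) + 1 \<le> card (B (Suc r))"
      using touch[OF BY, of r] by linarith
    have "(1 + \<epsilon>) ^ Suc (Suc r) \<le> (1 + \<epsilon>) * (\<epsilon> * card (B r) + 1)"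
      using Suc \<epsilon>(1) by simp
    also have "\<dots> = \<epsilon> * ((1 + \<epsilon>) * card (B r) + 1) + 1" by (simp add: algebra_simps)
    also have "\<dots> \<le> \<epsilon> * card (B (Suc r)) + 1" using 1 \<epsilon>(1) by (simp add: mult_left_mono)
    finally show ?case .
  qed
  \<comment> \<open>The largest radius that \<open>growth\<close> admits. As \<open>g\<close> is at
    most \<open>2 * Suc r\<close>, squaring the bound on the ball reaches the exponent
    \<open>g\<close>.\<close>
  define r where "r = (g - 1) div 2"
  have r: "2 * r + 1 \<le> g" "g \<le> Suc r * 2" using \<open>1 \<le> g\<close> by (auto simp: r_def)
  have "card (B r) \<le> card X"
    using BY[of r] Y(1) assms(1) by (intro card_mono) (auto simp: D_def)
  then have "\<epsilon> * card (B r) \<le> T" using \<epsilon> by (metis mult_left_mono of_nat_le_iff)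
  then have "(1 + \<epsilon>) ^ Suc r \<le> 1 + T" using growth[OF r(1)] by linarith
  then have "((1 + \<epsilon>) ^ Suc r)\<^sup>2 \<le> (1 + real T)\<^sup>2" using \<epsilon>(1) by (intro power_mono) auto
  then have "(1 + \<epsilon>) ^ (Suc r * 2) \<le> (1 + real T)\<^sup>2" by (simp only: power_mult)
  moreover have "(1 + \<epsilon>) ^ g \<le> (1 + \<epsilon>) ^ (Suc r * 2)"
    using r(2) \<epsilon>(1) by (intro power_increasing) auto
  ultimately show ?thesis unfolding \<epsilon>_def by linarith
qed

section \<open>Random deletion sets and the colors they destroy\<close>

text \<open>First moment argument: with \<open>w = card W\<close>, a fixed pair lies in a random
  \<open>z\<close>-subset of \<open>W\<close> with probability at most
  \<open>z (z - 1) / (w (w - 1))\<close>, and each index has at most \<open>m\<close> pairs.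
  Denominators are cleared to stay within the natural numbers.\<close>

lemma ex_subset_containing_few:
  fixes W :: "'a set" and P :: "'i \<Rightarrow> 'a set set"
  assumes "finite W" "finite I" "2 \<le> z" "z \<le> card W"
    and P: "\<And>i. i \<in> I \<Longrightarrow> finite (P i) \<and> card (P i) \<le> m" "\<And>i p. i \<in> I \<Longrightarrow> p \<in> P i \<Longrightarrow> card p = 2"
  shows "\<exists>Z \<subseteq> W. card Z = z \<and>
    card {i \<in> I. \<exists>p \<in> P i. p \<subseteq> Z} * (card W * (card W - 1)) \<le> m * card I * (z * (z - 1))"
proof (rule ccontr)
  assume contra: "\<not> ?thesis"
  define Q where "Q = {Z. Z \<subseteq> W \<and> card Z = z}"
  define h where "h Z = card {i \<in> I. \<exists>p \<in> P i. p \<subseteq> Z}" for Z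
  define w2 where "w2 = card W * (card W - 1)"
  have finQ: "finite Q" using assms(1) by (simp add: Q_def)
  have cardQ: "card Q = card W choose z" using n_subsets[OF assms(1)] by (simp add: Q_def)
  have binom: "(card W - 2 choose (z - 2)) * w2 = card Q * (z * (z - 1))"
  proof -
    obtain b where b: "z = Suc (Suc b)" using assms(3) by (metis Suc_le_D numeral_2_eq_2 Suc_le_mono)
    obtain a where a: "card W = Suc (Suc a)"
      using assms(3,4) by (metis Suc_le_D numeral_2_eq_2 Suc_le_mono le_trans)
    have "(a choose b) * (Suc (Suc a) * Suc a) = Suc (Suc a) * (Suc a * (a choose b))"
      by (simp only: ac_simps)
    also have "\<dots> = Suc b * (Suc (Suc a) * (Suc a choose Suc b))"
      by (simp only: Suc_times_binomial[symmetric] mult.left_commute)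
    also have "\<dots> = (Suc (Suc a) choose Suc (Suc b)) * (Suc (Suc b) * Suc b)"
      by (simp only: Suc_times_binomial[symmetric] ac_simps)
    finally show ?thesis by (simp add: cardQ w2_def a b)
  qed
  have containing: "card {Z \<in> Q. p \<subseteq> Z} \<le> (card W - 2 choose (z - 2))" if p: "card p = 2" for p
  proof (cases "p \<subseteq> W")
    case True
    have "finite p" using p by (metis card.infinite zero_neq_numeral)
    have "inj_on (\<lambda>Z. Z - p) {Z \<in> Q. p \<subseteq> Z}" by (auto simp: inj_on_def)
    moreover have "(\<lambda>Z. Z - p) ` {Z \<in> Q. p \<subseteq> Z} \<subseteq> {Y. Y \<subseteq> W - p \<and> card Y = z - 2}"
      using p \<open>finite p\<close> by (auto simp: Q_def card_Diff_subset)
    ultimately have "card {Z \<in> Q. p \<subseteq> Z} \<le> card {Y. Y \<subseteq> W - p \<and> card Y = z - 2}"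
      using assms(1) by (intro card_inj_on_le) auto
    also have "\<dots> = (card W - 2 choose (z - 2))"
      using n_subsets[of "W - p"] assms(1) True p \<open>finite p\<close> by (simp add: card_Diff_subset)
    finally show ?thesis .
  next
    case False
    then have "{Z \<in> Q. p \<subseteq> Z} = {}" by (auto simp: Q_def)
    then show ?thesis by (simp only: card.empty)
  qed
  have "Q \<noteq> {}" using assms(4) cardQ finQ by (metis binomial_eq_0_iff card.empty not_less)
  \<comment> \<open>If every \<open>Z\<close> exceeded the bound, so would the sum over all of them.
    Exchanging sums counts, for each pair, the sets \<open>Z\<close> that contain it.\<close>
  have "card Q * (m * card I * (z * (z - 1))) = (\<Sum>Z\<in>Q. m * card I * (z * (z - 1)))" by simp
  also have "\<dots> < (\<Sum>Z\<in>Q. h Z * w2)"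
    using contra finQ \<open>Q \<noteq> {}\<close> by (intro sum_strict_mono) (auto simp: Q_def h_def w2_def not_le)
  also have "\<dots> = (\<Sum>Z\<in>Q. h Z) * w2" by (simp add: sum_distrib_right)
  also have "(\<Sum>Z\<in>Q. h Z) \<le> (\<Sum>Z\<in>Q. \<Sum>i\<in>I. card {p \<in> P i. p \<subseteq> Z})"
  proof (rule sum_mono)
    fix Z
    have "h Z = (\<Sum>i\<in>I. if \<exists>p \<in> P i. p \<subseteq> Z then 1 else 0)"
      using assms(2) by (simp add: h_def sum.If_cases Int_def)
    also have "\<dots> \<le> (\<Sum>i\<in>I. card {p \<in> P i. p \<subseteq> Z})"
      using P(1) by (intro sum_mono) (auto simp: Suc_le_eq card_gt_0_iff)
    finally show "h Z \<le> (\<Sum>i\<in>I. card {p \<in> P i. p \<subseteq> Z})" .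
  qed
  also have "\<dots> = (\<Sum>i\<in>I. \<Sum>Z\<in>Q. card {p \<in> P i. p \<subseteq> Z})" by (rule sum.swap)
  also have "\<dots> = (\<Sum>i\<in>I. \<Sum>p\<in>P i. card {Z \<in> Q. p \<subseteq> Z})"
    using P(1) finQ by (intro sum.cong refl sum_multicount_gen) auto
  also have "\<dots> \<le> (\<Sum>i\<in>I. \<Sum>p\<in>P i. (card W - 2 choose (z - 2)))"
    using P(2) by (intro sum_mono containing) auto
  also have "\<dots> \<le> (\<Sum>i\<in>I. m * (card W - 2 choose (z - 2)))"
    using P(1) by (intro sum_mono) simp
  finally have "card Q * (m * card I * (z * (z - 1))) < m * card I * ((card W - 2 choose (z - 2)) * w2)"
    by (simp add: mult_right_mono ac_simps)
  then show False unfolding binom by (simp add: ac_simps)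
qed

text \<open>Let \<open>{a, b}\<close> be an edge of \<open>M\<close>. A cover contains
  \<open>a\<close> or \<open>b\<close>; with \<open>a\<close> it also needs an end of some edge
  avoiding \<open>a\<close>, and likewise for \<open>b\<close>. This leaves four pairs, chosen
  independently of \<open>Z\<close>.\<close>

lemma cover_contains_pair:
  assumes "\<And>e. e \<in> M \<Longrightarrow> card e = 2" "\<nexists>v. \<forall>e \<in> M. v \<in> e"
  shows "\<exists>P. finite P \<and> card P \<le> 4 \<and> (\<forall>p \<in> P. card p = 2) \<and>
    (\<forall>Z. (\<forall>e \<in> M. e \<inter> Z \<noteq> {}) \<longrightarrow> (\<exists>p \<in> P. p \<subseteq> Z))"
proof -
  obtain e where "e \<in> M" using assms(2) by blast
  then obtain a b where ab: "{a, b} \<in> M" using assms(1) by (metis card_2_iff)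
  obtain e1 e2 where e: "e1 \<in> M" "a \<notin> e1" "e2 \<in> M" "b \<notin> e2" using assms(2) by blast
  obtain x y where xy: "e1 = {x, y}" using assms(1)[OF e(1)] by (meson card_2_iff)
  obtain u v where uv: "e2 = {u, v}" using assms(1)[OF e(3)] by (meson card_2_iff)
  have "card {{a, x}, {a, y}, {b, u}, {b, v}} \<le> 4"
    using card_length[of "[{a, x}, {a, y}, {b, u}, {b, v}]"] by simp
  moreover have "\<exists>p \<in> {{a, x}, {a, y}, {b, u}, {b, v}}. p \<subseteq> Z" if "\<forall>e \<in> M. e \<inter> Z \<noteq> {}" for Z
  proof -
    have "{a, b} \<inter> Z \<noteq> {}" "{x, y} \<inter> Z \<noteq> {}" "{u, v} \<inter> Z \<noteq> {}" using that ab e xy uv by auto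
    then show ?thesis by auto
  qed
  moreover have "\<forall>p \<in> {{a, x}, {a, y}, {b, u}, {b, v}}. card p = 2"
    using e xy uv by auto
  ultimately show ?thesis
    by (intro exI[of _ "{{a, x}, {a, y}, {b, u}, {b, v}}"]) auto
qed

lemma card_star:
  assumes "\<And>e. e \<in> M \<Longrightarrow> card e = 2 \<and> v \<in> e"
  shows "card {y. {v, y} \<in> M} = card M"
proof (rule bij_betw_same_card)
  have "e \<in> (\<lambda>y. {v, y}) ` {y. {v, y} \<in> M}" if "e \<in> M" for e
  proof -
    have "card e = 2" using assms that by blast
    then obtain a b where "e = {a, b}" by (meson card_2_iff)
    then show ?thesis using assms[OF that] that by (auto simp: insert_commute)
  qed
  then show "bij_betw (\<lambda>y. {v, y}) {y. {v, y} \<in> M} M"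
    by (auto simp: bij_betw_def inj_on_def doubleton_eq_iff)
qed

section \<open>Rainbow cycles from many colors and from stars\<close>

text \<open>Keeping one edge of each color inside \<open>X\<close> makes every remaining cycle
  rainbow, and \<open>excess_edges_girth\<close> then forces a short one.\<close>

lemma rainbow_cycle_if_colors_exceed:
  fixes T g :: nat
  assumes "simple_graph V E" "X \<subseteq> V" "X \<noteq> {}"
    and "card X + T \<le> card (c ` {e \<in> E. e \<subseteq> X})"
    and "(1 + real T)\<^sup>2 < (1 + real T / real (card X)) ^ g" "1 \<le> g"
  shows "\<exists>C. cycle_in V E C \<and> rainbow c C \<and> length C \<le> g"
proof (rule ccontr)
  assume contra: "\<not> ?thesis"
  interpret simple_graph V E by fact
  have "finite X" using assms(2) finite_verts finite_subset by blast
  obtain F where F: "F \<subseteq> {e \<in> E. e \<subseteq> X}" "inj_on c F" "c ` {e \<in> E. e \<subseteq> X} = c ` F"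
    using subset_image_inj[of "c ` {e \<in> E. e \<subseteq> X}" c "{e \<in> E. e \<subseteq> X}"] by auto
  have "\<not> cycle_edges xs \<subseteq> F" if xs: "distinct xs" "3 \<le> length xs" "length xs \<le> g" for xs
  proof
    assume sub: "cycle_edges xs \<subseteq> F"
    have "rainbow c xs" using F(2) sub by (auto simp: rainbow_def inj_on_def)
    moreover have "set xs \<subseteq> V"
    proof
      fix x assume "x \<in> set xs"
      then obtain i where "i < length xs" "x = xs ! i" by (auto simp: in_set_conv_nth)
      then have "{x, xs ! (Suc i mod length xs)} \<in> F" using sub by (auto simp: cycle_edges_def)
      then show "x \<in> V" using F(1) assms(2) by auto
    qed
    ultimately show False
      using contra xs sub F(1) unfolding cycle_in_def by blast
  qed
  then have "(1 + real T / real (card X)) ^ g \<le> (1 + real T)\<^sup>2"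
    using assms(2-4,6) F \<open>finite X\<close> edge_card
    by (intro excess_edges_girth[of X F]) (auto simp: card_image)
  with assms(5) show False by linarith
qed

text \<open>An edge of color \<open>\<kappa> v\<close> at \<open>v\<close> becomes an arc leaving
  \<open>v\<close>. The arcs of a directed cycle have distinct tails, hence distinct colors.\<close>

lemma rainbow_cycle_if_stars:
  assumes "simple_graph V E" "S \<subseteq> V" "S \<noteq> {}" "inj_on \<kappa> S" "1 \<le> r"
    and "\<And>v. v \<in> S \<Longrightarrow> r \<le> card {y \<in> S. {v, y} \<in> E \<and> c {v, y} = \<kappa> v}"
  shows "\<exists>C. cycle_in V E C \<and> rainbow c C \<and> length C * Suc r \<le> 2 * card S"
proof -
  interpret simple_graph V E by fact
  define A where "A = {(v, y). v \<in> S \<and> y \<in> S \<and> {v, y} \<in> E \<and> c {v, y} = \<kappa> v}"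
  have "finite S" "A \<subseteq> S \<times> S"
    using assms(2) finite_verts finite_subset by (auto simp: A_def)
  moreover have "A `` {v} = {y \<in> S. {v, y} \<in> E \<and> c {v, y} = \<kappa> v}" if "v \<in> S" for v
    using that by (auto simp: A_def)
  ultimately obtain x l where l: "1 \<le> l" "(x, x) \<in> A ^^ l" "l * Suc r \<le> 2 * card S"
    using short_closed_walk[of S A r] assms(3,5,6) by auto
  then obtain l' where l': "l = Suc l'" by (cases l) auto
  obtain y where y: "(x, y) \<in> A" "(y, x) \<in> A ^^ l'"
    using l(2) unfolding l' by (rule relpow_Suc_E2)
  have "x \<noteq> y" using y(1) edge_card[of "{x, y}"] by (auto simp: A_def)
  \<comment> \<open>Opposite arcs would give one edge both colors \<open>\<kappa> x\<close> and
    \<open>\<kappa> y\<close>; so the cycle found has at least three vertices.\<close>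
  moreover have "(y, x) \<notin> A"
    using y(1) \<open>x \<noteq> y\<close> assms(4) by (auto simp: A_def insert_commute inj_on_def)
  ultimately obtain xs where xs: "distinct xs" "3 \<le> length xs" "length xs \<le> l"
    "\<And>i. i < length xs \<Longrightarrow> (xs ! i, xs ! (Suc i mod length xs)) \<in> A"
    using relpow_imp_cycle_arcs[OF y(2,1)] l' by auto
  have "set xs \<subseteq> V" using xs(4) assms(2) by (fastforce simp: in_set_conv_nth A_def)
  moreover have "cycle_edges xs \<subseteq> E" using xs(4) by (auto simp: cycle_edges_def A_def)
  moreover have "rainbow c xs"
    unfolding rainbow_def
  proof (intro ballI impI)
    fix e f assume "e \<in> cycle_edges xs" "f \<in> cycle_edges xs" "e \<noteq> f"
    then obtain i j where ij: "i < length xs" "j < length xs" "i \<noteq> j"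
      "e = {xs ! i, xs ! (Suc i mod length xs)}" "f = {xs ! j, xs ! (Suc j mod length xs)}"
      by (auto simp: cycle_edges_def)
    then have "xs ! i \<noteq> xs ! j" using xs(1) by (simp add: nth_eq_iff_index_eq)
    moreover have "c e = \<kappa> (xs ! i)" "c f = \<kappa> (xs ! j)" "xs ! i \<in> S" "xs ! j \<in> S"
      using xs(4)[OF ij(1)] xs(4)[OF ij(2)] ij(4,5) by (auto simp: A_def)
    ultimately show "c e \<noteq> c f" using assms(4) by (auto simp: inj_on_def)
  qed
  moreover have "length xs * Suc r \<le> 2 * card S"
    using xs(3) l(3) by (meson le_trans mult_le_mono1)
  ultimately show ?thesis using xs by (auto simp: cycle_in_def)
qed

section \<open>Numerical estimates\<close>

lemma log2_bounds:
  assumes "1 < (k::nat)"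
  shows "1 \<le> log 2 k" "log 2 k \<le> k" "2 \<le> k * log 2 k"
proof -
  show 1: "1 \<le> log 2 k" using assms by simp
  show "log 2 k \<le> k" using log2_of_power_less[of k k] assms less_exp[of k] by linarith
  have "2 * 1 \<le> k * log 2 k" using assms 1 by (intro mult_mono) auto
  then show "2 \<le> k * log 2 k" by simp
qed

text \<open>This contradicts the conclusion of \<open>excess_edges_girth\<close>. From
  \<open>T / m \<le> 1 / 8\<close> one gets \<open>ln (1 + x) \<ge> 7 / 8 * x\<close> for
  \<open>x = T / m\<close>, so the right side is at least \<open>exp (7 / 8 * T / k)\<close>. As
  \<open>16 * 7 / 8 = 14\<close>, this is at least \<open>k ^ 14\<close>, whereas the left side is
  below \<open>289 * k ^ 4\<close>.\<close>

lemma excess_threshold: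
  fixes k m g T :: nat
  assumes "1 < k" "16 * k * log 2 k \<le> T" "T \<le> 16 * k * log 2 k + 1"
    and "8 * T \<le> m" "real m / k \<le> g"
  shows "(1 + real T)\<^sup>2 < (1 + real T / m) ^ g"
proof -
  note L = log2_bounds[OF assms(1)]
  have "0 < T" using assms(2) L(3) by (cases T) auto
  with assms(4) have "0 < m" by linarith
  define x where "x = real T / m"
  have x: "0 < x" "x \<le> 1 / 8" using \<open>0 < T\<close> \<open>0 < m\<close> assms(4) by (auto simp: x_def field_simps)
  have "x * x \<le> 1 / 8 * x" using x by (intro mult_right_mono) auto
  moreover have "x - x * x \<le> ln (1 + x)"
    using ln_one_plus_pos_lower_bound[of x] x by (simp add: power2_eq_square)
  ultimately have ln: "7 / 8 * x \<le> ln (1 + x)" by linarith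
  have "1 + real T \<le> 16 * (k * real k) + 2"
    using assms(3) mult_left_mono[OF L(2), of "16 * real k"] by simp
  also have "\<dots> < 17 * (k * real k)"
  proof -
    have "2 * 2 \<le> k * real k" using assms(1) by (intro mult_mono) auto
    then show ?thesis by simp
  qed
  finally have "(1 + real T)\<^sup>2 < (17 * (k * real k))\<^sup>2" by (intro power_strict_mono) auto
  also have "\<dots> = 289 * real k ^ 4" by (simp add: power_mult_distrib eval_nat_numeral)
  also have "\<dots> \<le> real k ^ 10 * real k ^ 4"
  proof (rule mult_right_mono)
    have "(2::real) ^ 10 \<le> real k ^ 10" using assms(1) by (intro power_mono) auto
    then show "289 \<le> real k ^ 10" by simp
  qed simp
  also have "\<dots> = exp (14 * ln k)"
    using assms(1) by (simp add: exp_of_nat_mult[of 14, simplified] flip: power_add)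
  also have "14 * ln k \<le> 14 * log 2 k"
    using assms(1) ln_2_less_1 by (simp add: log_def field_simps mult_left_le)
  also have "14 * log 2 k \<le> 7 / 8 * T / k" using assms(1,2) by (simp add: field_simps)
  also have "\<dots> = 7 / 8 * x * (real m / k)" using \<open>0 < m\<close> by (simp add: x_def)
  also have "\<dots> \<le> ln (1 + x) * g" using ln assms(5) x by (intro mult_mono) auto
  also have "exp (ln (1 + x) * g) = (1 + x) ^ g" using x by (simp add: exp_of_nat2_mult)
  finally show ?thesis by (simp add: x_def)
qed

section \<open>The choice between stars and random deletion\<close>

theorem theorem2p1:
  fixes V :: "'a set" and E :: "'a set set" and c :: "'a set \<Rightarrow> nat" and k n :: nat
  assumes "k > 1" and "n \<ge> 1"
    and "simple_graph V E" and "card V = n"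
    and "c \<in> E \<rightarrow> {1..n}"
    and "\<And>i. i \<in> {1..n} \<Longrightarrow> real (card {e \<in> E. c e = i}) \<ge> 301 * real k * log 2 (real k)"
  shows "\<exists>C. cycle_in V E C \<and> rainbow c C \<and> int (cycle_length C) \<le> \<lceil>real n / real k\<rceil>"
proof -
  interpret simple_graph V E by fact
  note L = log2_bounds[OF assms(1)]
  define T where "T = nat \<lceil>16 * k * log 2 k\<rceil>"
  have T: "16 * k * log 2 k \<le> T" "T \<le> 16 * k * log 2 k + 1"
    using L by (auto simp: T_def)
  define M where "M i = {e \<in> E. c e = i}" for i
  have finE: "finite E"
    using finite_verts edge_subset by (auto intro: finite_subset[of E "Pow V"])
  have finM: "finite (M i)" for i using finE by (simp add: M_def)
  have cardM: "301 * (k * log 2 k) \<le> card (M i)" if "i \<in> {1..n}" for i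
    using assms(6)[OF that] by (simp add: M_def)
  \<comment> \<open>The \<open>n\<close> color classes are disjoint and together have at most
    \<open>n\<^sup>2 / 2\<close> edges.\<close>
  have n: "602 * (k * log 2 k) \<le> n"
  proof -
    have "n * (301 * (k * log 2 k)) = (\<Sum>i\<in>{1..n}. 301 * (k * log 2 k))" by simp
    also have "\<dots> \<le> (\<Sum>i\<in>{1..n}. real (card (M i)))" using cardM by (intro sum_mono)
    also have "\<dots> = card E"
    proof -
      have "E = (\<Union>i\<in>{1..n}. M i)" using assms(5) by (auto simp: M_def)
      moreover have "card (\<Union>i\<in>{1..n}. M i) = (\<Sum>i\<in>{1..n}. card (M i))"
        using finM by (intro card_UN_disjoint) (auto simp: M_def)
      ultimately show ?thesis by simp
    qed
    also have "card E \<le> card {e. e \<subseteq> V \<and> card e = 2}"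
      using finite_verts edge_subset edge_card by (intro card_mono) auto
    also have "\<dots> = n choose 2" using n_subsets[OF finite_verts] assms(4) by simp
    also have "real (n choose 2) \<le> n * (n / 2)"
    proof -
      have "2 * (n choose 2) \<le> n * (n - 1)" by (simp add: choose_two)
      also have "\<dots> \<le> n * n" by simp
      finally have "real (2 * (n choose 2)) \<le> real (n * n)" by (simp only: of_nat_le_iff)
      then show ?thesis by simp
    qed
    finally have "301 * (k * log 2 k) \<le> n / 2" using assms(2) by simp
    then show ?thesis by simp
  qed
  have finish: ?thesis
    if "cycle_in V E C" "rainbow c C" "length C \<le> \<lceil>real n / k\<rceil>" for C
    using that cycle_length_eq_length[of C] by (auto simp: cycle_in_def)

  define S where "S = {v \<in> V. \<exists>i \<in> {1..n}. \<forall>e \<in> M i. v \<in> e}"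
  define W where "W = V - S"
  define I where "I = {i \<in> {1..n}. \<nexists>v. \<forall>e \<in> M i. v \<in> e}"
  have finSW: "finite S" "finite W" using finite_verts by (auto simp: S_def W_def)
  have cardSW: "card S + card W = n"
    using card_Diff_subset[of S V] card_mono[of V S] finSW finite_verts assms(4)
    by (auto simp: W_def S_def)
  have "\<forall>v \<in> S. \<exists>i. i \<in> {1..n} \<and> (\<forall>e \<in> M i. v \<in> e)" by (auto simp: S_def)
  from bchoice[OF this] obtain \<kappa>
    where \<kappa>: "\<And>v. v \<in> S \<Longrightarrow> \<kappa> v \<in> {1..n} \<and> (\<forall>e \<in> M (\<kappa> v). v \<in> e)" by blast
  have ends: "card {y. {v, y} \<in> M i} = card (M i)" if "\<forall>e \<in> M i. v \<in> e" for v i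
    using that edge_card by (intro card_star) (auto simp: M_def)
  \<comment> \<open>Two centres of the same color would lie on all of its edges, leaving only the
    edge \<open>{u, v}\<close>.\<close>
  have inj: "inj_on \<kappa> S"
  proof (rule inj_onI, rule ccontr)
    fix u v assume uv: "u \<in> S" "v \<in> S" "\<kappa> u = \<kappa> v" "u \<noteq> v"
    have "e = {u, v}" if e: "e \<in> M (\<kappa> u)" for e
    proof -
      have "u \<in> e" "v \<in> e" using \<kappa>[OF uv(1)] \<kappa>[OF uv(2)] uv(3) e by auto
      moreover obtain a b where "e = {a, b}"
        using edge_card[of e] e unfolding M_def by (auto simp: card_2_iff)
      ultimately show ?thesis using uv(4) by auto
    qed
    then have "card (M (\<kappa> u)) \<le> card {{u, v}}" by (intro card_mono) auto
    moreover have "301 * (k * log 2 k) \<le> card (M (\<kappa> u))" using cardM \<kappa>[OF uv(1)] by blast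
    ultimately show False using L(3) by simp
  qed

  show ?thesis
  proof (cases "card W < 16 * T")
    case True
    \<comment> \<open>A star loses fewer than \<open>256 k log k + 16\<close> of its at least
      \<open>301 k log k\<close> leaves to \<open>W\<close>. The value \<open>2 * k - 1\<close>
      makes \<open>Suc r\<close> equal to \<open>2 * k\<close>, cancelling the factor 2 in the cycle
      bound.\<close>
    have out: "2 * k - 1 \<le> card {y \<in> S. {v, y} \<in> E \<and> c {v, y} = \<kappa> v}" if "v \<in> S" for v
    proof -
      let ?N = "{y \<in> S. {v, y} \<in> E \<and> c {v, y} = \<kappa> v}"
      have "{y. {v, y} \<in> M (\<kappa> v)} \<subseteq> ?N \<union> W" using edge_subset by (fastforce simp: M_def W_def)
      then have "card {y. {v, y} \<in> M (\<kappa> v)} \<le> card (?N \<union> W)"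
        using finSW by (intro card_mono) auto
      also have "\<dots> \<le> card ?N + card W" by (rule card_Un_le)
      finally have "card (M (\<kappa> v)) \<le> card ?N + card W" using ends \<kappa>[OF that] by simp
      moreover have "301 * (k * log 2 k) \<le> card (M (\<kappa> v))" using cardM \<kappa>[OF that] by blast
      moreover have "card W < 256 * (k * log 2 k) + 16" using True T(2) by linarith
      moreover have "real k * 1 \<le> k * log 2 k" using L(1) by (intro mult_left_mono) auto
      ultimately have "2 * real k \<le> card ?N" using L(3) by linarith
      then show ?thesis by linarith
    qed
    have "16 * T < n" using n T(2) L(3) by linarith
    then have "S \<noteq> {}" using True cardSW by auto
    moreover have "S \<subseteq> V" by (auto simp: S_def)
    moreover have "1 \<le> 2 * k - 1" using assms(1) by simp
    ultimately obtain C where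
      C: "cycle_in V E C" "rainbow c C" "length C * Suc (2 * k - 1) \<le> 2 * card S"
      using rainbow_cycle_if_stars[OF assms(3) _ _ inj _ out] by blast
    then have "length C * k \<le> n" using cardSW assms(1) by auto
    then have "real (length C) \<le> real n / k"
      using assms(1) by (simp add: field_simps flip: of_nat_mult)
    then have "int (length C) \<le> \<lceil>real n / k\<rceil>" by linarith
    with C(1,2) show ?thesis by (rule finish)
  next
    case False
    have "\<forall>i \<in> I. \<exists>P. finite P \<and> card P \<le> 4 \<and> (\<forall>p \<in> P. card p = 2) \<and>
        (\<forall>Z. (\<forall>e \<in> M i. e \<inter> Z \<noteq> {}) \<longrightarrow> (\<exists>p \<in> P. p \<subseteq> Z))"
      using edge_card by (intro ballI cover_contains_pair) (auto simp: I_def M_def)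
    then obtain P where P: "\<And>i. i \<in> I \<Longrightarrow> finite (P i) \<and> card (P i) \<le> 4 \<and> (\<forall>p \<in> P i. card p = 2) \<and>
        (\<forall>Z. (\<forall>e \<in> M i. e \<inter> Z \<noteq> {}) \<longrightarrow> (\<exists>p \<in> P i. p \<subseteq> Z))"
      by metis
    have "finite I" by (simp add: I_def)
    have T1: "1 \<le> T" using T(1) L(3) by linarith
    then obtain Z where Z: "Z \<subseteq> W" "card Z = 2 * T"
      "card {i \<in> I. \<exists>p \<in> P i. p \<subseteq> Z} * (card W * (card W - 1)) \<le> 4 * card I * (2 * T * (2 * T - 1))"
      using ex_subset_containing_few[OF finSW(2) \<open>finite I\<close>, of "2 * T" P 4] P False by auto
    define K where "K = {i \<in> I. \<exists>p \<in> P i. p \<subseteq> Z}"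
    \<comment> \<open>The colors \<open>\<kappa> v\<close> of the centres are distinct and lie
      outside \<open>I\<close>, so at most \<open>n - card S\<close> colors remain for
      \<open>I\<close>.\<close>
    have "card I \<le> card W"
    proof -
      have "\<kappa> ` S \<subseteq> {1..n} - I" using \<kappa> unfolding I_def by blast
      then have "card (\<kappa> ` S) \<le> card ({1..n} - I)" by (intro card_mono) auto
      also have "\<dots> = n - card I" using \<open>finite I\<close> by (subst card_Diff_subset) (auto simp: I_def)
      moreover have "card I \<le> n"
      proof -
        have "I \<subseteq> {1..n}" by (auto simp: I_def)
        from card_mono[OF _ this] show ?thesis by simp
      qed
      ultimately show ?thesis using card_image[OF inj] cardSW by linarith
    qed
    \<comment> \<open>With at least \<open>16 T\<close> vertices in \<open>W\<close>, the average
      number of destroyed colors is at most \<open>8 T (2 T - 1) / (16 T - 1)\<close>, which is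
      below \<open>T + 1\<close>.\<close>
    have "card K \<le> T"
    proof (rule ccontr)
      assume "\<not> ?thesis"
      have W0: "0 < card W" using False T1 by linarith
      have "(T + 1) * (card W * (card W - 1)) \<le> card K * (card W * (card W - 1))"
        using \<open>\<not> card K \<le> T\<close> by (intro mult_le_mono1) simp
      also have "\<dots> \<le> 4 * card W * (2 * T * (2 * T - 1))"
        using Z(3) \<open>card I \<le> card W\<close> unfolding K_def
        by (meson le_trans mult_le_mono1 mult_le_mono2)
      finally have "card W * ((T + 1) * (card W - 1)) \<le> card W * (8 * T * (2 * T - 1))"
        by (simp add: ac_simps)
      then have "(T + 1) * (card W - 1) \<le> 8 * T * (2 * T - 1)" using W0 by simp
      moreover have "(T + 1) * (16 * T - 1) \<le> (T + 1) * (card W - 1)"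
        using False by (intro mult_le_mono2) simp
      ultimately have "(T + 1) * (16 * T - 1) \<le> 8 * T * (2 * T - 1)" by linarith
      moreover obtain t where "T = Suc t" using T1 by (cases T) auto
      ultimately show False by (simp add: algebra_simps)
    qed
    define X where "X = V - Z"
    have ZV: "Z \<subseteq> V" "finite Z" using Z(1) finSW(2) finite_subset by (auto simp: W_def)
    then have cardX: "card X + 2 * T = n"
      using card_Diff_subset[of Z V] card_mono[of V Z] finite_verts assms(4) Z(2)
      by (simp add: X_def)
    \<comment> \<open>Ensures that \<open>card X\<close>, which is \<open>n - 2 * T\<close>, is at
      least \<open>8 * T\<close>, as \<open>excess_threshold\<close> requires.\<close>
    have big: "10 * T \<le> n" using n T(2) L(3) by linarith
    have survive: "\<exists>e \<in> M i. e \<inter> Z = {}" if i: "i \<in> {1..n}" "i \<notin> K" for i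
    proof (cases "i \<in> I")
      case True
      then have "\<not> (\<exists>p \<in> P i. p \<subseteq> Z)" using i(2) by (simp add: K_def)
      then show ?thesis using P[OF True] by blast
    next
      case False
      then obtain v where v: "\<forall>e \<in> M i. v \<in> e" using i by (auto simp: I_def)
      have "M i \<noteq> {}" using cardM[OF i(1)] L(3) by (intro notI) simp
      then have "v \<in> V" using v edge_subset by (fastforce simp: M_def)
      then have "v \<in> S" using v i(1) unfolding S_def by blast
      then have "v \<notin> Z" using Z(1) by (auto simp: W_def)
      \<comment> \<open>The centre of a star is never deleted, and the star has more leaves than
        \<open>Z\<close> has vertices.\<close>
      have "card Z < card {y. {v, y} \<in> M i}"
        using cardM[OF i(1)] ends[OF v] Z(2) T(2) L(3) by linarith
      then have "\<not> {y. {v, y} \<in> M i} \<subseteq> Z" using ZV(2) card_mono not_less by blast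
      then obtain y where "{v, y} \<in> M i" "y \<notin> Z" by blast
      then show ?thesis using \<open>v \<notin> Z\<close> by (intro bexI[of _ "{v, y}"]) auto
    qed
    have "{1..n} - K \<subseteq> c ` {e \<in> E. e \<subseteq> X}"
    proof
      fix i assume "i \<in> {1..n} - K"
      then obtain e where "e \<in> M i" "e \<inter> Z = {}" using survive by blast
      then show "i \<in> c ` {e \<in> E. e \<subseteq> X}"
        using edge_subset[of e] by (auto simp: M_def X_def)
    qed
    then have "card ({1..n} - K) \<le> card (c ` {e \<in> E. e \<subseteq> X})"
      using finE by (intro card_mono) auto
    moreover have "n - card K \<le> card ({1..n} - K)"
      using diff_card_le_card_Diff[of K "{1..n}"] \<open>finite I\<close> by (simp add: K_def)
    \<comment> \<open>Deletion costs \<open>2 * T\<close> vertices but at most \<open>T\<close> of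
      the \<open>n\<close> colors, so the surplus is at least \<open>T\<close>.\<close>
    ultimately have excess: "card X + T \<le> card (c ` {e \<in> E. e \<subseteq> X})"
      using \<open>card K \<le> T\<close> cardX by linarith
    define g where "g = nat \<lceil>real n / k\<rceil>"
    have "0 < real n / k" using assms(1,2) by simp
    then have "0 < \<lceil>real n / k\<rceil>" by (simp only: zero_less_ceiling)
    then have g: "int g = \<lceil>real n / k\<rceil>" "1 \<le> g" unfolding g_def by linarith+
    have g_ge: "real n / k \<le> g" unfolding g_def by (rule real_nat_ceiling_ge)
    have "real (card X) / k \<le> real n / k" using cardX by (intro divide_right_mono) auto
    then have "(1 + real T)\<^sup>2 < (1 + real T / card X) ^ g"
      using excess_threshold[OF assms(1) T, of "card X" g] g_ge big cardX by linarith
    moreover have "X \<noteq> {}" using cardX big T1 by auto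
    moreover have "X \<subseteq> V" by (auto simp: X_def)
    ultimately obtain C where C: "cycle_in V E C" "rainbow c C" "length C \<le> g"
      using rainbow_cycle_if_colors_exceed[OF assms(3) _ _ excess _ g(2)] by blast
    then have "int (length C) \<le> \<lceil>real n / k\<rceil>" using g(1) by linarith
    with C(1,2) show ?thesis by (rule finish)
  qed
qed

end
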